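(* For every ordered probability space $(S,\mathcal{F},\mu,\vartriangleleft)$ such that $(S,\mathcal{F},\mu)$ is atomless, there is an inclusion $f:(S,\mathcal{F},\mu,\vartriangleleft)\to([0,1],\mathcal{B},\lambda,<)$, where $\mathcal{B}$ is the Borel $\sigma$-algebra of $[0,1]$, $\lambda$ is the Lebesgue measure and $<$ is the standard order.
   Context: An ordered probability space $(S,\mathcal{F},\mu,\vartriangleleft)$ is a probability space $(S,\mathcal{F},\mu)$ equipped with a strict order relation $\vartriangleleft$ on $S$ (transitive and irreflexive) such that $\{(x,y): x\vartriangleleft y\}\in\mathcal{F}\otimes\mathcal{F}$ (the product $\sigma$-algebra). A function $f:S\to S'$ between probability spaces $(S,\mathcal{F},\mu)$ and $(S',\mathcal{F}',\mu')$ is measure-preserving if it is $(\mathcal{F},\mathcal{F}')$-measurable and $\mu(f^{-1}(A))=\mu'(A)$ for every $A\in\mathcal{F}'$. An inclusion between ordered probability spaces $(S,\mathcal{F},\mu,\vartriangleleft)$ and $(S',\mathcal{F}',\mu',\vartriangleleft')$ is a measure-preserving function $f:S\to S'$ such that the set $\{(x,y)\in S^2: x\vartriangleleft y,\ f(x)\not\vartriangleleft' f(y)\}$ has $\mu\otimes\mu$-measure zero. *)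

theory Defs
  imports "HOL-Probability.Probability"
begin

text \<open>The order is a relation on the underlying set \<open>space M\<close> only; values of \<open>lt\<close> outside
  \<open>space M\<close> are irrelevant.\<close>

locale ordered_prob_space = prob_space M
  for M :: "'a measure" and lt :: "'a \<Rightarrow> 'a \<Rightarrow> bool" +
  assumes lt_irrefl: "irreflp_on (space M) lt"
    and lt_trans: "transp_on (space M) lt"
    and lt_sets: "{(x, y) \<in> space M \<times> space M. lt x y} \<in> sets (M \<Otimes>\<^sub>M M)"

definition atomless :: "'a measure \<Rightarrow> bool" where
  "atomless M \<longleftrightarrow> (\<forall>A\<in>sets M. emeasure M A > 0 \<longrightarrow>
     (\<exists>B\<in>sets M. B \<subseteq> A \<and> 0 < emeasure M B \<and> emeasure M B < emeasure M A))"

definition measure_preserving :: "'a measure \<Rightarrow> 'b measure \<Rightarrow> ('a \<Rightarrow> 'b) \<Rightarrow> bool" where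
  "measure_preserving M N f \<longleftrightarrow> f \<in> M \<rightarrow>\<^sub>M N \<and>
     (\<forall>A\<in>sets N. emeasure M (f -` A \<inter> space M) = emeasure N A)"

locale ordered_prob_space_inclusion =
  source: ordered_prob_space M lt + target: ordered_prob_space N lt'
  for M :: "'a measure" and lt :: "'a \<Rightarrow> 'a \<Rightarrow> bool"
    and N :: "'b measure" and lt' :: "'b \<Rightarrow> 'b \<Rightarrow> bool"
    and f :: "'a \<Rightarrow> 'b" +
  assumes preserving: "measure_preserving M N f"
    and order_null: "{(x, y) \<in> space M \<times> space M. lt x y \<and> \<not> lt' (f x) (f y)}
      \<in> null_sets (M \<Otimes>\<^sub>M M)"

definition unit_interval :: "real measure" where
  "unit_interval = restrict_space lborel {0..1}"

lemma space_unit_interval: "space unit_interval = {0..1}"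
  by (simp add: unit_interval_def space_restrict_space)

lemma prob_space_unit_interval: "prob_space unit_interval"
  by (rule prob_spaceI)
    (simp add: unit_interval_def space_restrict_space emeasure_restrict_space)

lemma ordered_prob_space_unit_interval: "ordered_prob_space unit_interval (<)"
proof -
  interpret prob_space unit_interval by (rule prob_space_unit_interval)
  have [measurable]: "(\<lambda>x. x) \<in> unit_interval \<rightarrow>\<^sub>M borel"
    unfolding unit_interval_def by (intro measurable_restrict_space1) simp
  have [measurable]: "fst \<in> unit_interval \<Otimes>\<^sub>M unit_interval \<rightarrow>\<^sub>M borel"
    "snd \<in> unit_interval \<Otimes>\<^sub>M unit_interval \<rightarrow>\<^sub>M borel"
    using measurable_compose[OF measurable_fst, of "\<lambda>x. x" unit_interval borel unit_interval]
      measurable_compose[OF measurable_snd, of "\<lambda>x. x" unit_interval borel unit_interval]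
    by simp_all
  have "{p \<in> space (unit_interval \<Otimes>\<^sub>M unit_interval). fst p < snd p}
      \<in> sets (unit_interval \<Otimes>\<^sub>M unit_interval)"
    by measurable
  also have "{p \<in> space (unit_interval \<Otimes>\<^sub>M unit_interval). fst p < snd p}
      = {(x, y) \<in> space unit_interval \<times> space unit_interval. x < y}"
    by (auto simp: space_pair_measure)
  finally show ?thesis
    by unfold_locales (auto simp: irreflp_on_def transp_on_def)
qed

end

theory Submission
  imports Defs "HOL-Library.Fun_Lexorder"
begin

text \<open>The function \<open>rank x = \<mu> {z. z \<lhd> x}\<close> is weakly monotone, and it is strictly monotone on
  almost every comparable pair. To remove the remaining ties, atomlessness gives
  countably many measurable sets that separate almost all pairs of points. Ordering the points
  lexicographically, first by \<open>rank\<close> and then by membership in these sets, yields another ordered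
  probability space, total up to null sets. Applying the same argument to it shows that its rank
  function has null fibres; composing that function with its own distribution function makes it
  uniform on the unit interval.\<close>

section \<open>Null sets in product spaces\<close>

context pair_sigma_finite
begin

lemma null_sets_pairI1:
  assumes "A \<in> sets (M1 \<Otimes>\<^sub>M M2)"
    and "\<And>x. x \<in> space M1 \<Longrightarrow> emeasure M2 (Pair x -` A) = 0"
  shows "A \<in> null_sets (M1 \<Otimes>\<^sub>M M2)"
proof -
  have "emeasure (M1 \<Otimes>\<^sub>M M2) A = (\<integral>\<^sup>+x. emeasure M2 (Pair x -` A) \<partial>M1)"
    by (rule M2.emeasure_pair_measure_alt[OF assms(1)])
  also have "\<dots> = (\<integral>\<^sup>+x. 0 \<partial>M1)"
    by (rule nn_integral_cong) (simp add: assms(2))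
  finally show ?thesis using assms(1) by (simp add: null_setsI)
qed

lemma null_sets_pairI2:
  assumes "A \<in> sets (M1 \<Otimes>\<^sub>M M2)"
    and "\<And>y. y \<in> space M2 \<Longrightarrow> emeasure M1 ((\<lambda>x. (x, y)) -` A) = 0"
  shows "A \<in> null_sets (M1 \<Otimes>\<^sub>M M2)"
proof -
  have "emeasure (M1 \<Otimes>\<^sub>M M2) A = (\<integral>\<^sup>+y. emeasure M1 ((\<lambda>x. (x, y)) -` A) \<partial>M2)"
    by (rule emeasure_pair_measure_alt2[OF assms(1)])
  also have "\<dots> = (\<integral>\<^sup>+y. 0 \<partial>M2)"
    by (rule nn_integral_cong) (simp add: assms(2))
  finally show ?thesis using assms(1) by (simp add: null_setsI)
qed

end

text \<open>The product measure of \<open>E \<times> E\<close> is the square of the measure of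
  \<open>E\<close>.\<close>

lemma (in sigma_finite_measure) null_sets_if_square_null:
  assumes E: "E \<in> sets M" and N: "N \<in> null_sets (M \<Otimes>\<^sub>M M)" "E \<times> E \<subseteq> N"
  shows "E \<in> null_sets M"
proof -
  have "E \<times> E \<in> null_sets (M \<Otimes>\<^sub>M M)"
    using N E by (intro null_sets_subset[OF N(1)]) simp_all
  then have "emeasure M E * emeasure M E = 0"
    using emeasure_pair_measure_Times[OF E E] by (simp add: null_setsD1)
  then show ?thesis using E by (auto intro: null_setsI)
qed

section \<open>The rank function of an ordered probability space\<close>

context ordered_prob_space
begin

definition rank :: "'a \<Rightarrow> real" where
  "rank x = measure M {z \<in> space M. lt z x}"

lemma lt_transD: "lt x y \<Longrightarrow> lt y z \<Longrightarrow> x \<in> space M \<Longrightarrow> y \<in> space M \<Longrightarrow> z \<in> space M \<Longrightarrow> lt x z"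
  using lt_trans by (rule transp_onD)

lemma lt_irreflD: "x \<in> space M \<Longrightarrow> \<not> lt x x"
  using lt_irrefl by (rule irreflp_onD)

lemma pred_lt: "Measurable.pred (M \<Otimes>\<^sub>M M) (\<lambda>p. lt (fst p) (snd p))"
proof -
  have "{p \<in> space (M \<Otimes>\<^sub>M M). lt (fst p) (snd p)} = {(x, y) \<in> space M \<times> space M. lt x y}"
    by (auto simp: space_pair_measure)
  then show ?thesis using lt_sets by (simp add: pred_def)
qed

text \<open>In this composite form \<open>measurable\<close> can handle \<open>lt\<close> between
  any two measurable expressions.\<close>

lemma pred_lt_comp [measurable (raw)]:
  assumes "f \<in> N \<rightarrow>\<^sub>M M" "g \<in> N \<rightarrow>\<^sub>M M"
  shows "Measurable.pred N (\<lambda>x. lt (f x) (g x))"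
  using measurable_compose[OF measurable_Pair[OF assms] pred_lt] by simp

lemma rank_measurable [measurable]: "rank \<in> borel_measurable M"
proof -
  \<comment> \<open>The coordinates are swapped so that the section at \<open>x\<close> is the set
    of points below \<open>x\<close>.\<close>
  have "{p \<in> space (M \<Otimes>\<^sub>M M). lt (snd p) (fst p)} \<in> sets (M \<Otimes>\<^sub>M M)" (is "?A \<in> _")
    by measurable
  then have "(\<lambda>x. measure M (Pair x -` ?A)) \<in> borel_measurable M"
    unfolding measure_def by (intro borel_measurable_enn2real measurable_emeasure_Pair)
  moreover have "measure M (Pair x -` ?A) = rank x" if "x \<in> space M" for x
    unfolding rank_def using that by (intro arg_cong[where f="measure M"]) (auto simp: space_pair_measure)
  ultimately show ?thesis by (simp cong: measurable_cong)
qed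

lemma rank_mono: "lt x y \<Longrightarrow> x \<in> space M \<Longrightarrow> y \<in> space M \<Longrightarrow> rank x \<le> rank y"
  unfolding rank_def by (intro finite_measure_mono) (auto intro: lt_transD)

lemma rank_ties_below_null:
  assumes y: "y \<in> space M"
  shows "{x \<in> space M. lt x y \<and> rank x = rank y} \<in> null_sets M" (is "?E \<in> _")
proof -
  interpret P: pair_sigma_finite M M ..
  note y [measurable]
  have E [measurable]: "?E \<in> sets M" by measurable
  txt \<open>If \<open>x\<close> lies in the set then the lower sections of \<open>x\<close> and \<open>y\<close> agree up to a null set,
    so almost every \<open>z\<close> in the set lies below \<open>x\<close>; by Fubini \<open>z\<close> and \<open>x\<close> would almost
    always lie below each other.\<close>
  have gap: "emeasure M {z \<in> ?E. \<not> lt z x} = 0" if x: "x \<in> ?E" for x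
  proof -
    have [measurable]: "x \<in> space M" using x by simp
    have "measure M {z \<in> ?E. \<not> lt z x}
        \<le> measure M ({z \<in> space M. lt z y} - {z \<in> space M. lt z x})"
      by (rule finite_measure_mono) auto
    \<comment> \<open>By transitivity the lower section of \<open>x\<close> lies inside that of
      \<open>y\<close>, so the measures subtract.\<close>
    also have "\<dots> = rank y - rank x"
      unfolding rank_def using x y by (intro finite_measure_Diff) (auto intro: lt_transD)
    also have "\<dots> = 0" using x by simp
    finally show ?thesis
      by (simp add: emeasure_eq_measure measure_le_0_iff)
  qed
  \<comment> \<open>Mirror images of each other: the null sets of \<open>gap\<close> are the
    sections of \<open>P1\<close> with the second coordinate fixed, and of \<open>P2\<close> with
    the first fixed.\<close>
  define P1 where "P1 = {p \<in> space (M \<Otimes>\<^sub>M M). fst p \<in> ?E \<and> snd p \<in> ?E \<and> \<not> lt (fst p) (snd p)}"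
  define P2 where "P2 = {p \<in> space (M \<Otimes>\<^sub>M M). fst p \<in> ?E \<and> snd p \<in> ?E \<and> \<not> lt (snd p) (fst p)}"
  have "P1 \<in> null_sets (M \<Otimes>\<^sub>M M)"
  proof (rule P.null_sets_pairI2)
    show "P1 \<in> sets (M \<Otimes>\<^sub>M M)" unfolding P1_def by measurable
    fix x assume x: "x \<in> space M"
    have "(\<lambda>z. (z, x)) -` P1 = (if x \<in> ?E then {z \<in> ?E. \<not> lt z x} else {})"
      by (auto simp: P1_def space_pair_measure)
    then show "emeasure M ((\<lambda>z. (z, x)) -` P1) = 0" using gap[of x] by (simp split: if_splits)
  qed
  moreover have "P2 \<in> null_sets (M \<Otimes>\<^sub>M M)"
  proof (rule P.null_sets_pairI1)
    show "P2 \<in> sets (M \<Otimes>\<^sub>M M)" unfolding P2_def by measurable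
    fix x assume x: "x \<in> space M"
    have "Pair x -` P2 = (if x \<in> ?E then {z \<in> ?E. \<not> lt z x} else {})"
      by (auto simp: P2_def space_pair_measure)
    then show "emeasure M (Pair x -` P2) = 0" using gap[of x] by (simp split: if_splits)
  qed
  ultimately have "P1 \<union> P2 \<in> null_sets (M \<Otimes>\<^sub>M M)" by (rule null_sets.Un)
  then show ?thesis
  proof (rule null_sets_if_square_null[OF E])
    \<comment> \<open>A pair outside both sets would consist of two points below each other, against
      transitivity and irreflexivity.\<close>
    show "?E \<times> ?E \<subseteq> P1 \<union> P2"
      using lt_transD lt_irreflD by (simp add: P1_def P2_def space_pair_measure subset_iff) blast
  qed
qed

lemma rank_ties_null:
  "{p \<in> space (M \<Otimes>\<^sub>M M). lt (fst p) (snd p) \<and> rank (fst p) = rank (snd p)} \<in> null_sets (M \<Otimes>\<^sub>M M)"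
    (is "?A \<in> _")
proof -
  interpret P: pair_sigma_finite M M ..
  show ?thesis
  proof (rule P.null_sets_pairI2)
    show "?A \<in> sets (M \<Otimes>\<^sub>M M)" by measurable
    fix y assume y: "y \<in> space M"
    then have "(\<lambda>x. (x, y)) -` ?A = {x \<in> space M. lt x y \<and> rank x = rank y}"
      by (auto simp: space_pair_measure)
    then show "emeasure M ((\<lambda>x. (x, y)) -` ?A) = 0"
      using rank_ties_below_null[OF y] by (simp only: null_setsD1)
  qed
qed

end

section \<open>Null fibres and separation of points\<close>

text \<open>The square of a fibre consists of ties, so a fibre of positive measure would give the
  ties positive measure.\<close>

lemma (in prob_space) null_fibre_if_null_ties:
  fixes f :: "'a \<Rightarrow> real"
  assumes [measurable]: "f \<in> borel_measurable M"
    and ties: "{p \<in> space (M \<Otimes>\<^sub>M M). f (fst p) = f (snd p)} \<in> null_sets (M \<Otimes>\<^sub>M M)"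
  shows "{x \<in> space M. f x = c} \<in> null_sets M" (is "?E \<in> _")
proof (rule null_sets_if_square_null[OF _ ties])
  show "?E \<in> sets M" by measurable
  show "?E \<times> ?E \<subseteq> {p \<in> space (M \<Otimes>\<^sub>M M). f (fst p) = f (snd p)}"
    by (auto simp: space_pair_measure)
qed

text \<open>Countably many sets separating almost all pairs of points are found by minimising the measure
  of the set of unseparated pairs: countably many families can be merged into one, so the infimum is
  attained, and splitting a class of positive measure would decrease it further.\<close>

lemma (in prob_space) atomless_imp_separating_sets:
  assumes "atomless M"
  obtains B :: "nat \<Rightarrow> 'a set" where "\<And>n. B n \<in> sets M"
    "{p \<in> space (M \<Otimes>\<^sub>M M). \<forall>n. fst p \<in> B n \<longleftrightarrow> snd p \<in> B n} \<in> null_sets (M \<Otimes>\<^sub>M M)"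
proof -
  interpret P: pair_prob_space M M ..
  define agree where
    "agree B = {p \<in> space (M \<Otimes>\<^sub>M M). \<forall>n. fst p \<in> B n \<longleftrightarrow> snd p \<in> B n}" for B :: "nat \<Rightarrow> 'a set"
  define \<B> where "\<B> = {B :: nat \<Rightarrow> 'a set. \<forall>n. B n \<in> sets M}"
  define \<phi> where "\<phi> B = measure (M \<Otimes>\<^sub>M M) (agree B)" for B
  define i where "i = Inf (\<phi> ` \<B>)"
  have agree_sets: "agree B \<in> sets (M \<Otimes>\<^sub>M M)" if "B \<in> \<B>" for B
  proof -
    have [measurable]: "B n \<in> sets M" for n using that by (auto simp: \<B>_def)
    show ?thesis unfolding agree_def by measurable
  qed
  have i_le: "i \<le> \<phi> B" if "B \<in> \<B>" for B
    unfolding i_def by (rule cInf_lower) (use that in \<open>auto simp: \<phi>_def intro!: bdd_belowI2[where m=0]\<close>)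
  have "(\<lambda>n. {}) \<in> \<B>" by (simp add: \<B>_def)
  then have ne: "\<phi> ` \<B> \<noteq> {}" by blast
  have "\<exists>B\<in>\<B>. \<phi> B < i + inverse (real (Suc k))" for k
    using cInf_lessD[OF ne, of "i + inverse (real (Suc k))"] by (auto simp: i_def)
  then obtain Bk where Bk: "\<And>k. Bk k \<in> \<B>" "\<And>k. \<phi> (Bk k) < i + inverse (real (Suc k))"
    by metis
  \<comment> \<open>A single enumeration of the members of all families \<open>Bk k\<close>; it
    separates every pair that one of them separates, so it attains the infimum.\<close>
  define C where "C n = Bk (fst (prod_decode n)) (snd (prod_decode n))" for n
  have C: "C \<in> \<B>" using Bk(1) by (auto simp: \<B>_def C_def)
  have [measurable]: "C n \<in> sets M" for n using C by (auto simp: \<B>_def)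
  have sub: "agree C \<subseteq> agree (Bk k)" for k
  proof -
    have "Bk k m = C (prod_encode (k, m))" for m by (simp add: C_def)
    then show ?thesis by (auto simp: agree_def)
  qed
  have "\<phi> C \<le> i + inverse (real (Suc k))" for k
  proof -
    have "\<phi> C \<le> \<phi> (Bk k)"
      unfolding \<phi>_def by (rule P.finite_measure_mono[OF sub agree_sets[OF Bk(1)]])
    then show ?thesis using Bk(2)[of k] by simp
  qed
  then have \<phi>C: "\<phi> C \<le> i"
    by (intro LIMSEQ_le_const[OF LIMSEQ_inverse_real_of_nat_add]) auto
  have "agree C \<in> null_sets (M \<Otimes>\<^sub>M M)"
  proof (rule P.null_sets_pairI1[OF agree_sets[OF C]])
    fix x assume x: "x \<in> space M"
    define A where "A = {y \<in> space M. \<forall>n. x \<in> C n \<longleftrightarrow> y \<in> C n}"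
    have A: "A \<in> sets M" unfolding A_def by measurable
    have "emeasure M A = 0"
    proof (rule ccontr)
      assume "emeasure M A \<noteq> 0"
      then obtain D where D: "D \<in> sets M" "D \<subseteq> A" "0 < emeasure M D" "emeasure M D < emeasure M A"
        using assms A by (auto simp: atomless_def zero_less_iff_neq_zero)
      \<comment> \<open>Adding \<open>D\<close> to the family splits the class \<open>A\<close>:
        pairs in \<open>D \<times> (A - D)\<close> agree on \<open>C\<close> but not on
        \<open>C'\<close>. They have positive measure, so \<open>\<phi>\<close> drops below its
        infimum.\<close>
      define C' where "C' = case_nat D C"
      have C': "C' \<in> \<B>" using C D(1) by (auto simp: C'_def \<B>_def split: nat.split)
      have agree': "agree C' \<subseteq> agree C - D \<times> (A - D)"
      proof
        fix p assume p: "p \<in> agree C'"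
        have "fst p \<in> C' 0 \<longleftrightarrow> snd p \<in> C' 0" "\<And>n. fst p \<in> C' (Suc n) \<longleftrightarrow> snd p \<in> C' (Suc n)"
          using p by (auto simp: agree_def)
        then show "p \<in> agree C - D \<times> (A - D)"
          using p by (auto simp: agree_def C'_def)
      qed
      have DA: "D \<times> (A - D) \<subseteq> agree C"
        using D(2) by (auto simp: agree_def A_def space_pair_measure)
      have "measure M (A - D) = measure M A - measure M D"
        using A D by (intro finite_measure_Diff) auto
      then have "measure M D * measure M (A - D) > 0"
        using D by (auto simp: emeasure_eq_measure ennreal_less_iff)
      then have "measure (M \<Otimes>\<^sub>M M) (D \<times> (A - D)) > 0"
        using A D by (simp add: measure_def emeasure_pair_measure_Times enn2real_mult)
      then have "\<phi> C' < \<phi> C"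
        using P.finite_measure_mono[OF agree'] agree_sets[OF C] A D DA
        by (simp add: \<phi>_def P.finite_measure_Diff)
      then show False using i_le[OF C'] \<phi>C by simp
    qed
    moreover have "Pair x -` agree C = A"
      using x by (auto simp: agree_def A_def space_pair_measure)
    ultimately show "emeasure M (Pair x -` agree C) = 0" by simp
  qed
  then show thesis using that[of C] C by (auto simp: \<B>_def agree_def)
qed


section \<open>The probability integral transform\<close>

lemma id_unit_interval_measurable: "(\<lambda>x. x) \<in> borel_measurable unit_interval"
  unfolding unit_interval_def by (intro measurable_restrict_space1) simp

lemma measure_preserving_unit_interval_measurable:
  assumes "measure_preserving M unit_interval f"
  shows "f \<in> borel_measurable M"
  using assms measurable_compose[OF _ id_unit_interval_measurable, of f M]
  by (simp add: measure_preserving_def)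

text \<open>Null fibres leave the law of \<open>f\<close> without point masses, so its distribution
  function is continuous and attains every level strictly between 0 and 1. This fixes the
  distribution function of the composite, and hence its law.\<close>

lemma (in prob_space) cdf_comp_uniform:
  fixes f :: "'a \<Rightarrow> real"
  assumes [measurable]: "f \<in> borel_measurable M"
    and fibres: "\<And>c. {x \<in> space M. f x = c} \<in> null_sets M"
  shows "measure_preserving M unit_interval (\<lambda>x. cdf (distr M borel f) (f x))"
proof -
  define D where "D = distr M borel f"
  interpret D: real_distribution D unfolding D_def by (rule real_distribution_distr) simp
  interpret U: prob_space unit_interval by (rule prob_space_unit_interval)
  have cont: "isCont (cdf D) c" for c
  proof -
    have "f -` {c} \<inter> space M = {x \<in> space M. f x = c}" by auto
    then have "measure D {c} = 0"
      using null_setsD1[OF fibres[of c]] by (simp add: D_def measure_distr measure_eq_emeasure_eq_ennreal)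
    then show ?thesis by (simp add: D.isCont_cdf)
  qed
  have mono: "mono (cdf D)" by (intro monoI D.cdf_nondecreasing)
  have [measurable]: "cdf D \<in> borel_measurable borel"
    by (rule borel_measurable_mono[OF mono])
  define u where "u x = cdf D (f x)" for x
  have [measurable]: "u \<in> borel_measurable M" unfolding u_def by measurable
  have u01: "u x \<in> {0..1}" for x by (simp add: u_def D.cdf_nonneg D.cdf_bounded_prob)
  have u_unit: "u \<in> M \<rightarrow>\<^sub>M unit_interval"
    unfolding unit_interval_def by (rule measurable_restrict_space2) (use u01 in auto)
  have unit_below: "measure unit_interval ({..t} \<inter> {0..1}) = t" if "0 \<le> t" "t < 1" for t
  proof -
    have "{..t} \<inter> {0..1} = {0..t}" using that by auto
    then show ?thesis
      using that by (simp add: unit_interval_def measure_restrict_space)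
  qed
  have u_below: "measure M {x \<in> space M. u x \<le> t} = t" if t: "0 < t" "t < 1" for t
  proof -
    define S where "S = {c. cdf D c \<le> t}"
    have closed: "closed S"
      unfolding S_def using cont by (intro closed_Collect_le) (auto simp: continuous_at_imp_continuous_on)
    obtain a where a: "cdf D a < t"
      using order_tendstoD(2)[OF D.cdf_lim_at_bot t(1)] by (auto simp: eventually_at_bot_linorder)
    obtain b where b: "t < cdf D b"
      using order_tendstoD(1)[OF D.cdf_lim_at_top_prob t(2)] by (auto simp: eventually_at_top_linorder)
    have ab: "a \<le> b" using a b D.cdf_nondecreasing[of b a] by linarith
    have S_le: "c \<le> b" if "c \<in> S" for c
      using that b D.cdf_nondecreasing[of b c] unfolding S_def by force
    then have bdd: "bdd_above S" by (rule bdd_aboveI)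
    obtain c where c: "cdf D c = t"
      using IVT[of "cdf D" a t b] a b ab cont by auto
    \<comment> \<open>The largest point where the distribution function is at most \<open>t\<close>.
      That function may be constant at level \<open>t\<close> on an interval, so the preimage
      \<open>c\<close> alone need not describe the event \<open>u x \<le> t\<close>.\<close>
    define s where "s = Sup S"
    have cS: "c \<in> S" using c by (simp add: S_def)
    have "s \<in> S" unfolding s_def by (rule closed_contains_Sup[OF _ bdd closed]) (use cS in auto)
    moreover have "c \<le> s" unfolding s_def using cS bdd by (rule cSup_upper)
    ultimately have s: "cdf D s = t"
      using c D.cdf_nondecreasing[of c s] by (auto simp: S_def)
    have "u x \<le> t \<longleftrightarrow> f x \<le> s" for x
    proof
      assume "u x \<le> t"
      then have "f x \<in> S" by (simp add: u_def S_def)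
      then show "f x \<le> s" unfolding s_def using bdd by (rule cSup_upper)
    next
      assume "f x \<le> s"
      then show "u x \<le> t" using D.cdf_nondecreasing[of "f x" s] s by (simp add: u_def)
    qed
    then have "{x \<in> space M. u x \<le> t} = f -` {..s} \<inter> space M" by auto
    then have "measure M {x \<in> space M. u x \<le> t} = cdf D s"
      by (simp add: cdf_def D_def measure_distr)
    then show ?thesis using s by simp
  qed
  \<comment> \<open>Level 0 need not be attained by the distribution function, so this case is
    obtained by letting \<open>t\<close> decrease to 0.\<close>
  have u_zero: "measure M {x \<in> space M. u x \<le> 0} = 0"
  proof (rule antisym)
    have "measure M {x \<in> space M. u x \<le> 0} \<le> t" if "0 < t" "t < 1" for t
    proof -
      have "measure M {x \<in> space M. u x \<le> 0} \<le> measure M {x \<in> space M. u x \<le> t}"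
        by (rule finite_measure_mono) (use that in auto)
      then show ?thesis using u_below[OF that] by simp
    qed
    then show "measure M {x \<in> space M. u x \<le> 0} \<le> 0"
      by (rule dense_ge_bounded[OF zero_less_one])
  qed simp
  \<comment> \<open>Both laws are taken on the whole real line, where equality of distribution
    functions suffices.\<close>
  have law: "distr M borel u = distr unit_interval borel (\<lambda>x. x)"
  proof (rule cdf_unique)
    show "real_distribution (distr M borel u)" by (rule real_distribution_distr) simp
    show "real_distribution (distr unit_interval borel (\<lambda>x. x))"
      by (rule U.real_distribution_distr) (rule id_unit_interval_measurable)
    show "cdf (distr M borel u) = cdf (distr unit_interval borel (\<lambda>x. x))"
    proof
      fix t
      have l: "cdf (distr M borel u) t = measure M {x \<in> space M. u x \<le> t}"
        by (auto simp: cdf_def measure_distr intro!: arg_cong[where f="measure M"])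
      have r: "cdf (distr unit_interval borel (\<lambda>x. x)) t = measure unit_interval ({..t} \<inter> {0..1})"
        by (simp add: cdf_def measure_distr id_unit_interval_measurable space_unit_interval)
      consider "t < 0" | "t = 0" | "0 < t" "t < 1" | "1 \<le> t" by linarith
      then show "cdf (distr M borel u) t = cdf (distr unit_interval borel (\<lambda>x. x)) t"
      proof cases
        case 1
        then have "\<not> u x \<le> t" for x using u01[of x] by simp
        moreover have "{..t} \<inter> {0..1} = {}" using 1 by auto
        ultimately show ?thesis by (simp add: l r)
      next
        case 2
        then show ?thesis unfolding l r using u_zero unit_below[of 0] by simp
      next
        case 3
        then show ?thesis using u_below unit_below by (simp add: l r)
      next
        case 4
        then have "{x \<in> space M. u x \<le> t} = space M" "{..t} \<inter> {0..1} = space unit_interval"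
          using u01 by (auto simp: space_unit_interval intro: order_trans)
        then show ?thesis by (simp add: l r prob_space U.prob_space)
      qed
    qed
  qed
  have "emeasure M (u -` A \<inter> space M) = emeasure unit_interval A" if A: "A \<in> sets unit_interval" for A
  proof -
    have A': "A \<in> sets borel" "A \<subseteq> {0..1}"
      using A by (auto simp: unit_interval_def sets_restrict_space)
    have "emeasure M (u -` A \<inter> space M) = emeasure (distr M borel u) A"
      using A' by (simp add: emeasure_distr)
    also have "\<dots> = emeasure unit_interval (A \<inter> {0..1})"
      using A' by (simp add: law emeasure_distr id_unit_interval_measurable space_unit_interval)
    finally show ?thesis using A' by (simp add: Int_absorb2)
  qed
  then have "measure_preserving M unit_interval u"
    using u_unit by (simp add: measure_preserving_def)
  then show ?thesis by (simp add: u_def[abs_def] D_def)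
qed

text \<open>Each fibre over a value of \<open>f\<close> has the Lebesgue measure of a single point,
  and Fubini collects these fibres.\<close>

lemma (in prob_space) measure_preserving_unit_interval_null_ties:
  assumes f: "measure_preserving M unit_interval f"
  shows "{p \<in> space (M \<Otimes>\<^sub>M M). f (fst p) = f (snd p)} \<in> null_sets (M \<Otimes>\<^sub>M M)" (is "?A \<in> _")
proof -
  interpret P: pair_sigma_finite M M ..
  have fM: "f \<in> M \<rightarrow>\<^sub>M unit_interval" using f by (simp add: measure_preserving_def)
  note measure_preserving_unit_interval_measurable[OF f, measurable]
  show ?thesis
  proof (rule P.null_sets_pairI1)
    show "?A \<in> sets (M \<Otimes>\<^sub>M M)" by measurable
    fix x assume x: "x \<in> space M"
    then have fx: "f x \<in> {0..1}" using measurable_space[OF fM] by (simp add: space_unit_interval)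
    then have "{f x} \<in> sets unit_interval" by (auto simp: unit_interval_def sets_restrict_space)
    then have "emeasure M (f -` {f x} \<inter> space M) = emeasure unit_interval {f x}"
      using f by (simp add: measure_preserving_def)
    also have "\<dots> = 0" using fx by (simp add: unit_interval_def emeasure_restrict_space)
    also have "f -` {f x} \<inter> space M = Pair x -` ?A" using x by (auto simp: space_pair_measure)
    finally show "emeasure M (Pair x -` ?A) = 0" .
  qed
qed

section \<open>The lexicographic refinement and the inclusion\<close>

theorem theorem1p10:
  fixes M :: "'a measure" and lt :: "'a \<Rightarrow> 'a \<Rightarrow> bool"
  assumes "ordered_prob_space M lt"
    and "atomless M"
  shows "\<exists>f :: 'a \<Rightarrow> real. ordered_prob_space_inclusion M lt unit_interval (<) f"
proof -
  interpret L: ordered_prob_space M lt by fact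
  obtain B :: "nat \<Rightarrow> 'a set" where B [measurable]: "\<And>n. B n \<in> sets M"
    and sep: "{p \<in> space (M \<Otimes>\<^sub>M M). \<forall>n. fst p \<in> B n \<longleftrightarrow> snd p \<in> B n} \<in> null_sets (M \<Otimes>\<^sub>M M)"
    using L.atomless_imp_separating_sets[OF assms(2)] by blast
  \<comment> \<open>The code of \<open>x\<close> under the separating sets; \<open>less_fun\<close>
    compares two codes at the first index where they differ, with \<open>False\<close> below
    \<open>True\<close>.\<close>
  define bits where "bits x n \<longleftrightarrow> x \<in> B n" for x n
  define lex where
    "lex x y \<longleftrightarrow> L.rank x < L.rank y \<or> L.rank x = L.rank y \<and> less_fun (bits x) (bits y)" for x y
  \<comment> \<open>Distinct codes have a first difference, which decides any tie of
    \<open>L.rank\<close>. By \<open>sep\<close>, almost all pairs have distinct codes.\<close>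
  have lex_total: "lex x y \<or> lex y x" if "bits x \<noteq> bits y" for x y
  proof -
    define k where "k = (LEAST n. bits x n \<noteq> bits y n)"
    have "\<exists>n. bits x n \<noteq> bits y n" using that by blast
    then have "bits x k \<noteq> bits y k" unfolding k_def by (rule LeastI_ex)
    moreover have "bits x j = bits y j" if "j < k" for j
      using not_less_Least that unfolding k_def by blast
    ultimately have "less_fun (bits x) (bits y) \<or> less_fun (bits y) (bits x)"
      unfolding less_fun_def less_bool_def by metis
    then show ?thesis using linorder_less_linear[of "L.rank x" "L.rank y"] unfolding lex_def by auto
  qed
  interpret R: ordered_prob_space M lex
  proof unfold_locales
    show "irreflp_on (space M) lex" by (auto simp: irreflp_on_def lex_def less_fun_irrefl)
    show "transp_on (space M) lex" by (auto simp: transp_on_def lex_def intro: less_fun_trans)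
    \<comment> \<open>Only countable and finite quantifiers remain in this form, so
      \<open>measurable\<close> applies.\<close>
    have "{(x, y) \<in> space M \<times> space M. lex x y} = {p \<in> space (M \<Otimes>\<^sub>M M).
        L.rank (fst p) < L.rank (snd p) \<or> L.rank (fst p) = L.rank (snd p) \<and>
        (\<exists>k. (fst p \<notin> B k \<and> snd p \<in> B k) \<and> (\<forall>j\<in>{..<k}. fst p \<in> B j \<longleftrightarrow> snd p \<in> B j))}"
      by (auto simp: lex_def less_fun_def bits_def space_pair_measure)
    also have "\<dots> \<in> sets (M \<Otimes>\<^sub>M M)" by measurable
    finally show "{(x, y) \<in> space M \<times> space M. lex x y} \<in> sets (M \<Otimes>\<^sub>M M)" .
  qed
  let ?f = R.rank
  let ?ties = "\<lambda>g. {p \<in> space (M \<Otimes>\<^sub>M M). g (fst p) = g (snd p)}"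
  let ?T = "{p \<in> space (M \<Otimes>\<^sub>M M). lex (fst p) (snd p) \<and> ?f (fst p) = ?f (snd p)}"
  let ?T' = "{p \<in> space (M \<Otimes>\<^sub>M M). lex (snd p) (fst p) \<and> ?f (fst p) = ?f (snd p)}"
  interpret P: pair_sigma_finite M M ..
  \<comment> \<open>The mirror image of \<open>R.rank_ties_null\<close>, since a tied pair may be
    ordered either way.\<close>
  have "?T' \<in> null_sets (M \<Otimes>\<^sub>M M)"
  proof (rule P.null_sets_pairI1)
    show "?T' \<in> sets (M \<Otimes>\<^sub>M M)" by measurable
    fix x assume x: "x \<in> space M"
    then have "Pair x -` ?T' = {y \<in> space M. lex y x \<and> ?f y = ?f x}"
      by (auto simp: space_pair_measure)
    then show "emeasure M (Pair x -` ?T') = 0"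
      using R.rank_ties_below_null[OF x] by (simp only: null_setsD1)
  qed
  with R.rank_ties_null have "?T \<union> ?T' \<in> null_sets (M \<Otimes>\<^sub>M M)" by (rule null_sets.Un)
  then have "?T \<union> ?T' \<union> {p \<in> space (M \<Otimes>\<^sub>M M). \<forall>n. fst p \<in> B n \<longleftrightarrow> snd p \<in> B n}
      \<in> null_sets (M \<Otimes>\<^sub>M M)"
    using sep by (rule null_sets.Un)
  then have "?ties ?f \<in> null_sets (M \<Otimes>\<^sub>M M)"
  proof (rule null_sets_subset)
    show "?ties ?f \<in> sets (M \<Otimes>\<^sub>M M)" by measurable
    \<comment> \<open>A tied pair is comparable under \<open>lex\<close> in one direction or the
      other, unless the two codes coincide.\<close>
    show "?ties ?f \<subseteq> ?T \<union> ?T' \<union> {p \<in> space (M \<Otimes>\<^sub>M M). \<forall>n. fst p \<in> B n \<longleftrightarrow> snd p \<in> B n}"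
      using lex_total by (auto simp: bits_def fun_eq_iff)
  qed
  then have fibres: "{x \<in> space M. ?f x = c} \<in> null_sets M" for c
    by (intro L.null_fibre_if_null_ties R.rank_measurable)
  define u where "u x = cdf (distr M borel ?f) (?f x)" for x
  have u: "measure_preserving M unit_interval u"
    unfolding u_def using R.rank_measurable fibres by (rule L.cdf_comp_uniform)
  interpret D: real_distribution "distr M borel ?f"
    by (rule L.real_distribution_distr) (rule R.rank_measurable)
  interpret U: ordered_prob_space unit_interval "(<)"
    by (rule ordered_prob_space_unit_interval)
  let ?N = "{(x, y) \<in> space M \<times> space M. lt x y \<and> \<not> u x < u y}"
  let ?S = "{p \<in> space (M \<Otimes>\<^sub>M M). lt (fst p) (snd p) \<and> L.rank (fst p) = L.rank (snd p)}"
  note measure_preserving_unit_interval_measurable[OF u, measurable]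
  have "?S \<union> ?ties u \<in> null_sets (M \<Otimes>\<^sub>M M)"
    using L.rank_ties_null L.measure_preserving_unit_interval_null_ties[OF u] by (rule null_sets.Un)
  moreover have "?N = {p \<in> space (M \<Otimes>\<^sub>M M). lt (fst p) (snd p) \<and> \<not> u (fst p) < u (snd p)}"
    by (auto simp: space_pair_measure)
  then have "?N \<in> sets (M \<Otimes>\<^sub>M M)" by simp
  \<comment> \<open>Strictness can fail only on ties of \<open>L.rank\<close> or of
    \<open>u\<close>. Elsewhere \<open>lt\<close> raises \<open>L.rank\<close>, which gives
    \<open>lex\<close>, and \<open>R.rank\<close> and the distribution function preserve this
    weakly.\<close>
  moreover have "?N \<subseteq> ?S \<union> ?ties u"
  proof (rule subsetI, rule UnCI)
    fix p assume "p \<in> ?N" "p \<notin> ?ties u"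
    then obtain x y where p: "p = (x, y)"
      and *: "x \<in> space M" "y \<in> space M" "lt x y" "\<not> u x < u y" and "u x \<noteq> u y"
      by (auto simp: space_pair_measure)
    have "L.rank x = L.rank y"
    proof (rule ccontr)
      assume "L.rank x \<noteq> L.rank y"
      then have "lex x y" using L.rank_mono[of x y] * by (simp add: lex_def)
      then have "?f x \<le> ?f y" using R.rank_mono * by simp
      then have "u x \<le> u y" unfolding u_def by (rule D.cdf_nondecreasing)
      then show False using * \<open>u x \<noteq> u y\<close> by simp
    qed
    then show "p \<in> ?S" using * p by (simp add: space_pair_measure)
  qed
  ultimately have "?N \<in> null_sets (M \<Otimes>\<^sub>M M)" by (rule null_sets_subset)
  with u have "ordered_prob_space_inclusion M lt unit_interval (<) u"
    by (intro ordered_prob_space_inclusion.intro ordered_prob_space_inclusion_axioms.intro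
        L.ordered_prob_space_axioms U.ordered_prob_space_axioms)
  then show ?thesis by blast
qed

end
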